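(* Let $F(n)$ be the number of isomorphism classes of threshold matroids on a ground set of size $n$. Then \[F(n)=\binom{n+1}{2}+\binom{n+1}{4}+\binom{n+1}{6}+\binom{n-1}{6},\] where $\binom{a}{b}=0$ whenever $a<b$.
   Context: A rank $k$ matroid $M$ on ground set $E$ is threshold if there is $w:E\to\mathbb{R}$ such that for every $k$-element $B\subseteq E$, $B$ is a basis of $M$ iff $\sum_{b\in B}w(b)>0$. Matroids of all ranks are counted. *)

theory Defs
  imports Complex_Main
begin

text \<open>A matroid is given by its finite ground set and its family of independent sets.\<close>

definition matroid :: "'a set \<Rightarrow> 'a set set \<Rightarrow> bool" where
  "matroid E \<I> \<longleftrightarrow>
     finite E \<and> \<I> \<subseteq> Pow E \<and> {} \<in> \<I> \<and>
     (\<forall>X Y. X \<in> \<I> \<and> Y \<subseteq> X \<longrightarrow> Y \<in> \<I>) \<and>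
     (\<forall>X Y. X \<in> \<I> \<and> Y \<in> \<I> \<and> card X < card Y \<longrightarrow> (\<exists>y\<in>Y - X. insert y X \<in> \<I>))"

definition matroid_basis :: "'a set set \<Rightarrow> 'a set \<Rightarrow> bool" where
  "matroid_basis \<I> B \<longleftrightarrow> B \<in> \<I> \<and> (\<forall>X\<in>\<I>. B \<subseteq> X \<longrightarrow> X = B)"

definition matroid_rank :: "'a set set \<Rightarrow> nat" where
  "matroid_rank \<I> = Max (card ` \<I>)"

text \<open>
  The inequality is strict, so a matroid of rank 0 is never threshold: its only basis is the
  empty set, whose weight is 0.
\<close>

definition threshold_matroid :: "'a set \<Rightarrow> 'a set set \<Rightarrow> bool" where
  "threshold_matroid E \<I> \<longleftrightarrow>
     matroid E \<I> \<and>
     (\<exists>w :: 'a \<Rightarrow> real. \<forall>B. B \<subseteq> E \<and> card B = matroid_rank \<I> \<longrightarrow>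
        (matroid_basis \<I> B \<longleftrightarrow> (\<Sum>b\<in>B. w b) > 0))"

definition matroid_isomorphic ::
    "'a set \<Rightarrow> 'a set set \<Rightarrow> 'b set \<Rightarrow> 'b set set \<Rightarrow> bool" where
  "matroid_isomorphic E \<I> E' \<I>' \<longleftrightarrow>
     (\<exists>f. bij_betw f E E' \<and> (\<forall>X. X \<subseteq> E \<longrightarrow> (X \<in> \<I> \<longleftrightarrow> f ` X \<in> \<I>')))"

definition threshold_matroids :: "'a set \<Rightarrow> 'a set set set" where
  "threshold_matroids E = {\<I>. threshold_matroid E \<I>}"

definition threshold_matroid_iso :: "'a set \<Rightarrow> ('a set set \<times> 'a set set) set" where
  "threshold_matroid_iso E =
     {(\<I>, \<J>). \<I> \<in> threshold_matroids E \<and> \<J> \<in> threshold_matroids E \<and>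
        matroid_isomorphic E \<I> E \<J>}"

lemma equiv_threshold_matroid_iso: "equiv (threshold_matroids E) (threshold_matroid_iso E)"
proof (rule equivI)
  show "threshold_matroid_iso E \<subseteq> threshold_matroids E \<times> threshold_matroids E"
    by (auto simp: threshold_matroid_iso_def)
  show "refl_on (threshold_matroids E) (threshold_matroid_iso E)"
    by (auto simp: refl_on_def threshold_matroid_iso_def matroid_isomorphic_def
        intro!: exI[of _ id])
  show "sym (threshold_matroid_iso E)"
  proof (rule symI)
    fix \<I> \<J> assume *: "(\<I>, \<J>) \<in> threshold_matroid_iso E"
    then obtain f where f: "bij_betw f E E" "\<forall>X. X \<subseteq> E \<longrightarrow> (X \<in> \<I> \<longleftrightarrow> f ` X \<in> \<J>)"
      by (auto simp: threshold_matroid_iso_def matroid_isomorphic_def)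
    let ?g = "inv_into E f"
    have g: "bij_betw ?g E E" using f(1) by (rule bij_betw_inv_into)
    have "X \<in> \<J> \<longleftrightarrow> ?g ` X \<in> \<I>" if "X \<subseteq> E" for X
    proof -
      have "f ` ?g ` X = X"
        using f(1) that by (simp add: bij_betw_def image_inv_into_cancel)
      moreover have "?g ` X \<subseteq> E" using g that by (auto simp: bij_betw_def)
      ultimately show ?thesis using f(2) by metis
    qed
    with g * show "(\<J>, \<I>) \<in> threshold_matroid_iso E"
      unfolding threshold_matroid_iso_def matroid_isomorphic_def by auto
  qed
  show "trans (threshold_matroid_iso E)"
  proof (rule transI)
    fix \<I> \<J> \<K>
    assume *: "(\<I>, \<J>) \<in> threshold_matroid_iso E" "(\<J>, \<K>) \<in> threshold_matroid_iso E"
    then obtain f g where f: "bij_betw f E E" "\<forall>X. X \<subseteq> E \<longrightarrow> (X \<in> \<I> \<longleftrightarrow> f ` X \<in> \<J>)"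
      and g: "bij_betw g E E" "\<forall>X. X \<subseteq> E \<longrightarrow> (X \<in> \<J> \<longleftrightarrow> g ` X \<in> \<K>)"
      by (auto simp: threshold_matroid_iso_def matroid_isomorphic_def)
    have "X \<in> \<I> \<longleftrightarrow> (g \<circ> f) ` X \<in> \<K>" if "X \<subseteq> E" for X
    proof -
      have "f ` X \<subseteq> E" using f(1) that by (auto simp: bij_betw_def)
      then show ?thesis using f(2) g(2) that by (simp add: image_comp)
    qed
    moreover have "bij_betw (g \<circ> f) E E" using f(1) g(1) by (rule bij_betw_trans)
    ultimately show "(\<I>, \<K>) \<in> threshold_matroid_iso E"
      using * unfolding threshold_matroid_iso_def matroid_isomorphic_def by blast
  qed
qed

definition threshold_matroid_classes :: "'a set \<Rightarrow> 'a set set set set" where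
  "threshold_matroid_classes E = threshold_matroids E // threshold_matroid_iso E"

end

theory Submission
  imports Defs "HOL-Library.Sublist"
begin

text \<open>
  Ordering the ground set by increasing weight, bases are preserved by moving elements up, so a
  threshold matroid is nested: for some \<open>S \<subseteq> {0, \<dots>, n - 1}\<close>, a set is independent iff each prefix contains
  at most as many of its elements as of \<open>S\<close>. Since \<open>S\<close> can be recovered from the isomorphism type,
  the task is to count the threshold sets \<open>S\<close>, viewed as binary words of length \<open>n\<close>. These turn out
  to be the nonzero words having neither 10101010 nor 10110010 as a subsequence: such a subsequence yields
  two bases and two nonbases with the same multiset of elements, while without one the inequalities
  for the prefixes can be merged into a single one, since at most two of them matter besides those
  describing loops and coloops. Letter by letter, the two patterns reduce to words avoiding a
  single pattern of length \<open>l\<close>, whose number is the sum of \<open>n choose i\<close> over \<open>i < l\<close>.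
\<close>

section \<open>Matroids and isomorphisms\<close>

lemma matroid_finite:
  assumes "matroid E \<I>"
  shows "finite \<I>" "\<And>X. X \<in> \<I> \<Longrightarrow> finite X"
  using assms by (auto simp: matroid_def intro: finite_subset rev_finite_subset)

lemma matroid_subset: "matroid E \<I> \<Longrightarrow> X \<in> \<I> \<Longrightarrow> Y \<subseteq> X \<Longrightarrow> Y \<in> \<I>"
  unfolding matroid_def by blast

lemma matroid_augment:
  "matroid E \<I> \<Longrightarrow> X \<in> \<I> \<Longrightarrow> Y \<in> \<I> \<Longrightarrow> card X < card Y \<Longrightarrow> \<exists>y\<in>Y - X. insert y X \<in> \<I>"
  unfolding matroid_def by blast

lemma card_le_matroid_rank: "matroid E \<I> \<Longrightarrow> X \<in> \<I> \<Longrightarrow> card X \<le> matroid_rank \<I>"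
  unfolding matroid_rank_def by (intro Max_ge finite_imageI imageI matroid_finite(1))

lemma matroid_rank_attained:
  assumes "matroid E \<I>"
  obtains B where "B \<in> \<I>" "card B = matroid_rank \<I>"
proof -
  have "matroid_rank \<I> \<in> card ` \<I>"
    unfolding matroid_rank_def
    using matroid_finite(1)[OF assms] assms by (intro Max_in) (auto simp: matroid_def)
  then show ?thesis by (elim imageE) (rule that, simp_all)
qed

lemma matroid_extend_to_rank:
  assumes M: "matroid E \<I>" and "X \<in> \<I>"
  shows "\<exists>B\<in>\<I>. X \<subseteq> B \<and> card B = matroid_rank \<I>"
  using \<open>X \<in> \<I>\<close>
proof (induction "matroid_rank \<I> - card X" arbitrary: X)
  case 0
  then show ?case using card_le_matroid_rank[OF M] by force
next
  case (Suc m)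
  obtain B where B: "B \<in> \<I>" "card B = matroid_rank \<I>"
    using matroid_rank_attained[OF M] .
  then obtain y where y: "y \<in> B - X" "insert y X \<in> \<I>"
    using matroid_augment[OF M Suc.prems, of B] Suc.hyps(2) by (metis diff_is_0_eq nat.simps(3) not_le_imp_less)
  then have "m = matroid_rank \<I> - card (insert y X)"
    using Suc.hyps(2) matroid_finite[OF M] Suc.prems by simp
  then show ?case using Suc.hyps(1) y(2) by blast
qed

text \<open>An independent set smaller than the rank extends to one of full size, so a maximal one
  has full size. This lets independence replace maximality in the threshold condition.\<close>

lemma matroid_basis_iff_card:
  assumes M: "matroid E \<I>"
  shows "matroid_basis \<I> B \<longleftrightarrow> B \<in> \<I> \<and> card B = matroid_rank \<I>"
proof
  assume "matroid_basis \<I> B"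
  then show "B \<in> \<I> \<and> card B = matroid_rank \<I>"
    using matroid_extend_to_rank[OF M, of B] by (auto simp: matroid_basis_def)
next
  assume B: "B \<in> \<I> \<and> card B = matroid_rank \<I>"
  have "X = B" if "X \<in> \<I>" "B \<subseteq> X" for X
    using card_le_matroid_rank[OF M] card_seteq[of X B] matroid_finite(2)[OF M] that B by auto
  with B show "matroid_basis \<I> B" by (auto simp: matroid_basis_def)
qed

lemma threshold_matroid_iff:
  "threshold_matroid E \<I> \<longleftrightarrow> matroid E \<I> \<and>
    (\<exists>w :: 'a \<Rightarrow> real. \<forall>B. B \<subseteq> E \<and> card B = matroid_rank \<I> \<longrightarrow> (B \<in> \<I> \<longleftrightarrow> (\<Sum>b\<in>B. w b) > 0))"
proof (cases "matroid E \<I>")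
  case True
  then show ?thesis
    unfolding threshold_matroid_def matroid_basis_iff_card[OF True] by (simp cong: conj_cong)
qed (simp add: threshold_matroid_def)

section \<open>Isomorphisms and transport along bijections\<close>

lemma matroid_isomorphic_sym:
  assumes "matroid_isomorphic E \<I> E' \<I>'"
  shows "matroid_isomorphic E' \<I>' E \<I>"
proof -
  obtain f where f: "bij_betw f E E'" "\<And>X. X \<subseteq> E \<Longrightarrow> X \<in> \<I> \<longleftrightarrow> f ` X \<in> \<I>'"
    using assms unfolding matroid_isomorphic_def by blast
  have "X \<in> \<I>' \<longleftrightarrow> inv_into E f ` X \<in> \<I>" if "X \<subseteq> E'" for X
  proof -
    have "f ` inv_into E f ` X = X" "inv_into E f ` X \<subseteq> E"
      using f(1) that bij_betw_inv_into[OF f(1)]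
      by (simp_all add: bij_betw_def image_inv_into_cancel) blast
    then show ?thesis using f(2) by metis
  qed
  then show ?thesis
    unfolding matroid_isomorphic_def using bij_betw_inv_into[OF f(1)] by blast
qed

lemma matroid_isomorphic_trans:
  assumes "matroid_isomorphic E \<I> E' \<I>'" "matroid_isomorphic E' \<I>' E'' \<I>''"
  shows "matroid_isomorphic E \<I> E'' \<I>''"
proof -
  obtain f where f: "bij_betw f E E'" "\<And>X. X \<subseteq> E \<Longrightarrow> X \<in> \<I> \<longleftrightarrow> f ` X \<in> \<I>'"
    using assms unfolding matroid_isomorphic_def by blast
  obtain g where g: "bij_betw g E' E''" "\<And>X. X \<subseteq> E' \<Longrightarrow> X \<in> \<I>' \<longleftrightarrow> g ` X \<in> \<I>''"
    using assms unfolding matroid_isomorphic_def by blast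
  have "X \<in> \<I> \<longleftrightarrow> (g \<circ> f) ` X \<in> \<I>''" if "X \<subseteq> E" for X
  proof -
    have "f ` X \<subseteq> E'" using f(1) that by (auto simp: bij_betw_def)
    then show ?thesis using f(2) g(2) that by (simp add: image_comp)
  qed
  then show ?thesis
    unfolding matroid_isomorphic_def using bij_betw_trans[OF f(1) g(1)] by blast
qed

lemma image_mem_image_image_iff:
  assumes "inj_on f E" "\<I> \<subseteq> Pow E" "X \<subseteq> E"
  shows "f ` X \<in> (`) f ` \<I> \<longleftrightarrow> X \<in> \<I>"
proof
  assume "f ` X \<in> (`) f ` \<I>"
  then obtain Y where "Y \<in> \<I>" "f ` Y = f ` X" by auto
  moreover have "Y \<subseteq> E" using \<open>Y \<in> \<I>\<close> assms(2) by auto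
  ultimately show "X \<in> \<I>" using inj_on_image_eq_iff[OF assms(1), of Y X] assms(3) by simp
qed simp

lemma matroid_isomorphic_image:
  assumes "bij_betw f E E'" "\<I> \<subseteq> Pow E"
  shows "matroid_isomorphic E \<I> E' ((`) f ` \<I>)"
  unfolding matroid_isomorphic_def
  using assms image_mem_image_image_iff[of f E \<I>] by (intro exI[of _ f]) (simp add: bij_betw_def)

lemma matroid_image:
  assumes M: "matroid E \<I>" and f: "bij_betw f E E'"
  shows "matroid E' ((`) f ` \<I>)" "matroid_rank ((`) f ` \<I>) = matroid_rank \<I>"
proof -
  have sub: "X \<subseteq> E" if "X \<in> \<I>" for X using M that by (auto simp: matroid_def)
  have inj: "inj_on f E" and im: "f ` E = E'" using f by (auto simp: bij_betw_def)
  have card: "card (f ` X) = card X" if "X \<in> \<I>" for X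
    using card_image inj_on_subset[OF inj sub[OF that]] by blast
  have "\<exists>y\<in>f ` Y - f ` X. insert y (f ` X) \<in> (`) f ` \<I>"
    if XY: "X \<in> \<I>" "Y \<in> \<I>" "card (f ` X) < card (f ` Y)" for X Y
  proof -
    obtain y where y: "y \<in> Y - X" "insert y X \<in> \<I>"
      using matroid_augment[OF M XY(1,2)] XY card by auto
    then have "f y \<notin> f ` X" using inj sub XY by (auto simp: inj_on_def subset_iff)
    moreover have "insert (f y) (f ` X) \<in> (`) f ` \<I>"
      using y(2) by (metis image_eqI image_insert)
    ultimately show ?thesis using y(1) by blast
  qed
  moreover have "Z \<in> (`) f ` \<I>" if "X \<in> \<I>" "Z \<subseteq> f ` X" for X Z
    using matroid_subset[OF M \<open>X \<in> \<I>\<close>] that by (metis image_eqI subset_imageE)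
  moreover have "finite E'" "(`) f ` \<I> \<subseteq> Pow E'" "{} \<in> (`) f ` \<I>"
    using M im by (auto simp: matroid_def)
  ultimately show "matroid E' ((`) f ` \<I>)"
    unfolding matroid_def by blast
  have "card ` (`) f ` \<I> = card ` \<I>"
    unfolding image_image using card by (intro image_cong) auto
  then show "matroid_rank ((`) f ` \<I>) = matroid_rank \<I>"
    by (simp add: matroid_rank_def)
qed

lemma threshold_matroid_image:
  fixes f :: "'a \<Rightarrow> 'b"
  assumes "threshold_matroid E \<I>" and f: "bij_betw f E E'"
  shows "threshold_matroid E' ((`) f ` \<I>)"
proof -
  obtain w :: "'a \<Rightarrow> real" where M: "matroid E \<I>" and
    w: "\<And>B. B \<subseteq> E \<Longrightarrow> card B = matroid_rank \<I> \<Longrightarrow> B \<in> \<I> \<longleftrightarrow> sum w B > 0"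
    using assms(1) unfolding threshold_matroid_iff by blast
  have inj: "inj_on f E" and im: "f ` E = E'" using f by (auto simp: bij_betw_def)
  have "B' \<in> (`) f ` \<I> \<longleftrightarrow> (\<Sum>b\<in>B'. w (inv_into E f b)) > 0"
    if B': "B' \<subseteq> E'" "card B' = matroid_rank \<I>" for B'
  proof -
    obtain B where B: "B \<subseteq> E" "B' = f ` B"
      using B'(1) im by (metis subset_imageE)
    have injB: "inj_on f B" using inj B(1) by (rule inj_on_subset)
    have "(\<Sum>b\<in>B'. w (inv_into E f b)) = sum w B"
      unfolding B(2) sum.reindex[OF injB] using B(1) inj by (intro sum.cong) auto
    moreover have "B' \<in> (`) f ` \<I> \<longleftrightarrow> B \<in> \<I>"
      unfolding B(2) using image_mem_image_image_iff[OF inj _ B(1), of \<I>] M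
      by (simp add: matroid_def)
    moreover have "card B = matroid_rank \<I>"
      using B'(2) card_image[OF injB] B(2) by simp
    ultimately show ?thesis using w B(1) by simp
  qed
  then show ?thesis
    unfolding threshold_matroid_iff matroid_image(2)[OF M f]
    using matroid_image(1)[OF M f] by (auto intro!: exI[of _ "\<lambda>b. w (inv_into E f b)"])
qed

section \<open>Nested matroids\<close>

definition prefix_card :: "nat set \<Rightarrow> nat \<Rightarrow> nat" where
  "prefix_card X j = card (X \<inter> {..<j})"

lemma prefix_card_0 [simp]: "prefix_card X 0 = 0"
  by (simp add: prefix_card_def)

lemma prefix_card_Suc: "prefix_card X (Suc j) = prefix_card X j + of_bool (j \<in> X)"
  by (simp add: prefix_card_def lessThan_Suc Int_insert_right)

lemma prefix_card_mono: "i \<le> j \<Longrightarrow> prefix_card X i \<le> prefix_card X j"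
  unfolding prefix_card_def by (intro card_mono) auto

lemma prefix_card_subset: "X \<subseteq> Y \<Longrightarrow> prefix_card X j \<le> prefix_card Y j"
  unfolding prefix_card_def by (intro card_mono) auto

lemma prefix_card_all: "X \<subseteq> {..<n} \<Longrightarrow> prefix_card X n = card X"
  by (simp add: prefix_card_def Int_absorb2)

lemma prefix_card_le: "prefix_card X j \<le> j"
  using card_mono[of "{..<j}" "X \<inter> {..<j}"] by (simp add: prefix_card_def)

lemma prefix_card_split:
  assumes "i \<le> j"
  shows "prefix_card X j = prefix_card X i + card (X \<inter> {i..<j})"
proof -
  have "X \<inter> {..<j} = (X \<inter> {..<i}) \<union> (X \<inter> {i..<j})" using assms by auto
  then show ?thesis
    unfolding prefix_card_def by (simp add: card_Un_disjoint disjoint_iff)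
qed

lemma prefix_card_insert:
  assumes "x \<notin> X"
  shows "prefix_card (insert x X) j = prefix_card X j + of_bool (x < j)"
  using assms by (simp add: prefix_card_def)

lemma prefix_card_inject:
  assumes "S \<subseteq> {..<n}" "T \<subseteq> {..<n}" "\<And>j. j \<le> n \<Longrightarrow> prefix_card S j = prefix_card T j"
  shows "S = T"
proof -
  have "j \<in> S \<longleftrightarrow> j \<in> T" if "j < n" for j
    using assms(3)[of j] assms(3)[of "Suc j"] that
    by (auto simp: prefix_card_Suc of_bool_def split: if_splits)
  then show ?thesis using assms(1,2) by blast
qed

definition swap_elem :: "nat \<Rightarrow> nat \<Rightarrow> nat set \<Rightarrow> nat set" where
  "swap_elem a b X = insert b (X - {a})"

lemma swap_elem_mem: "x \<in> swap_elem a b X \<longleftrightarrow> x = b \<or> x \<in> X \<and> x \<noteq> a"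
  by (auto simp: swap_elem_def)

lemma prefix_card_swap_elem:
  assumes "a \<in> X" "b \<notin> X"
  shows "int (prefix_card (swap_elem a b X) j) =
    int (prefix_card X j) + of_bool (b < j) - of_bool (a < j)"
proof -
  have "prefix_card X j = prefix_card (X - {a}) j + of_bool (a < j)"
    using prefix_card_insert[of a "X - {a}"] assms(1) by (simp add: insert_absorb)
  moreover have "prefix_card (swap_elem a b X) j = prefix_card (X - {a}) j + of_bool (b < j)"
    unfolding swap_elem_def by (intro prefix_card_insert) (use assms in auto)
  ultimately show ?thesis by simp
qed

lemma swap_elem_sum_card:
  fixes w :: "nat \<Rightarrow> real"
  assumes "finite X" "a \<in> X" "b \<notin> X"
  shows "sum w (swap_elem a b X) = sum w X - w a + w b" "card (swap_elem a b X) = card X"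
  using assms card_Suc_Diff1[of X a] by (auto simp: swap_elem_def sum_diff1)

text \<open>Also known as Schubert or generalized Catalan matroids. For \<open>S\<close> inside
  \<open>{..<n}\<close>, \<open>S\<close> is a basis, and the bases are the sets of the same size in
  \<open>{..<n}\<close> whose i-th smallest element is at least that of \<open>S\<close>, for each
  i.\<close>

definition nested_matroid :: "nat \<Rightarrow> nat set \<Rightarrow> nat set set" where
  "nested_matroid n S = {X. X \<subseteq> {..<n} \<and> (\<forall>j\<le>n. prefix_card X j \<le> prefix_card S j)}"

text \<open>Moving an element up removes it from some prefixes and adds it to none, so no prefix
  count increases.\<close>

lemma nested_matroid_swap_elem:
  assumes "X \<in> nested_matroid n S" "a \<in> X" "b \<notin> X" "a < b" "b < n"
  shows "swap_elem a b X \<in> nested_matroid n S"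
proof -
  have "prefix_card (swap_elem a b X) j \<le> prefix_card X j" for j
    using prefix_card_swap_elem[OF assms(2,3), of j] assms(4) by (auto simp: of_bool_def split: if_splits)
  moreover have "swap_elem a b X \<subseteq> {..<n}"
    using assms(1,5) by (auto simp: nested_matroid_def swap_elem_def)
  ultimately show ?thesis
    using assms(1) order_trans unfolding nested_matroid_def by blast
qed

lemma matroid_nested_matroid: "matroid {..<n} (nested_matroid n S)"
proof -
  have "\<exists>y\<in>Y - X. insert y X \<in> nested_matroid n S"
    if X: "X \<in> nested_matroid n S" and Y: "Y \<in> nested_matroid n S" and lt: "card X < card Y" for X Y
  proof -
    have XY: "X \<subseteq> {..<n}" "Y \<subseteq> {..<n}" using X Y by (auto simp: nested_matroid_def)
    \<comment> \<open>The last prefix length at which \<open>Y\<close> is not ahead of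
      \<open>X\<close> serves as the new element. Beyond it \<open>Y\<close> is strictly ahead, so
      \<open>j\<close> lies in \<open>Y - X\<close>, and there the counts of
      \<open>insert j X\<close> stay at most those of \<open>Y\<close>, hence of
      \<open>S\<close>.\<close>
    let ?J = "{j. j \<le> n \<and> prefix_card Y j \<le> prefix_card X j}"
    define j where "j = Max ?J"
    have J: "finite ?J" by auto
    have "0 \<in> ?J" by simp
    then have "j \<in> ?J" unfolding j_def using J Max_in by blast
    moreover have "j \<noteq> n"
      using \<open>j \<in> ?J\<close> lt XY by (auto simp: prefix_card_all)
    ultimately have j: "j < n" "prefix_card Y j \<le> prefix_card X j" by auto
    have above: "prefix_card X i < prefix_card Y i" if "j < i" "i \<le> n" for i
      using Max_ge[OF J, of i] that unfolding j_def[symmetric] by force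
    have jYX: "j \<in> Y - X"
      using above[of "Suc j"] j by (auto simp: prefix_card_Suc of_bool_def split: if_splits)
    have "prefix_card (insert j X) i \<le> prefix_card S i" if "i \<le> n" for i
    proof (cases "j < i")
      case True
      then have "prefix_card (insert j X) i \<le> prefix_card Y i"
        using above[OF True that] jYX by (simp add: prefix_card_insert)
      also have "\<dots> \<le> prefix_card S i" using Y that by (simp add: nested_matroid_def)
      finally show ?thesis .
    next
      case False
      then show ?thesis using X jYX that by (simp add: prefix_card_insert nested_matroid_def)
    qed
    then show ?thesis using jYX XY j(1) by (auto simp: nested_matroid_def)
  qed
  moreover have "Y \<in> nested_matroid n S" if "X \<in> nested_matroid n S" "Y \<subseteq> X" for X Y
    using that prefix_card_subset[OF that(2)] le_trans unfolding nested_matroid_def by blast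
  moreover have "nested_matroid n S \<subseteq> Pow {..<n}" "{} \<in> nested_matroid n S"
    by (auto simp: nested_matroid_def prefix_card_def)
  ultimately show ?thesis unfolding matroid_def by blast
qed

lemma matroid_rank_nested_matroid:
  assumes "S \<subseteq> {..<n}"
  shows "matroid_rank (nested_matroid n S) = card S"
proof -
  have "S \<in> nested_matroid n S" using assms by (simp add: nested_matroid_def)
  moreover have "card X \<le> card S" if "X \<in> nested_matroid n S" for X
    using that assms unfolding nested_matroid_def
    by (metis (mono_tags, lifting) le_refl mem_Collect_eq prefix_card_all)
  ultimately show ?thesis
    unfolding matroid_rank_def
    using matroid_finite(1)[OF matroid_nested_matroid] by (intro Max_eqI) auto
qed

text \<open>Induction removing the maximum \<open>m\<close> of \<open>A\<close>. As \<open>A\<close>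
  has \<open>Suc j\<close> elements, \<open>m\<close> is at least \<open>j\<close>; so adding
  \<open>m\<close> back affects only prefixes containing \<open>{..<Suc j}\<close>, where
  \<open>S\<close> already has \<open>prefix_card S (Suc j)\<close> elements.\<close>

lemma nested_matroid_rank_ge:
  assumes "finite A" "card A = j"
  shows "\<exists>X\<subseteq>A. card X = prefix_card S j \<and> (\<forall>i. prefix_card X i \<le> prefix_card S i)"
  using assms
proof (induction j arbitrary: A)
  case 0
  then show ?case by (auto simp: prefix_card_def)
next
  case (Suc j)
  define m where "m = Max A"
  have mA: "m \<in> A" unfolding m_def using Suc.prems by (intro Max_in) auto
  have A: "A \<subseteq> {..m}" unfolding m_def using Suc.prems(1) by auto
  have "j \<le> m" using card_mono[OF _ A] Suc.prems(2) by simp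
  have "finite (A - {m})" "card (A - {m}) = j" using Suc.prems mA by auto
  then obtain X where X: "X \<subseteq> A - {m}" "card X = prefix_card S j"
      "\<And>i. prefix_card X i \<le> prefix_card S i"
    using Suc.IH[of "A - {m}"] by auto
  show ?case
  proof (cases "j \<in> S")
    case True
    have fX: "finite X" "m \<notin> X" using X(1) Suc.prems(1) finite_subset by auto
    have "prefix_card (insert m X) i \<le> prefix_card S i" for i
    proof (cases "m < i")
      case True
      have "prefix_card (insert m X) i \<le> card (insert m X)"
        unfolding prefix_card_def using fX by (intro card_mono) auto
      also have "\<dots> = prefix_card S (Suc j)"
        using fX X(2) \<open>j \<in> S\<close> by (simp add: prefix_card_Suc)
      also have "\<dots> \<le> prefix_card S i"
        using True \<open>j \<le> m\<close> by (intro prefix_card_mono) simp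
      finally show ?thesis .
    next
      case False
      then show ?thesis using X(3) fX by (simp add: prefix_card_insert)
    qed
    then show ?thesis
      using X fX True mA by (intro exI[of _ "insert m X"]) (auto simp: prefix_card_Suc)
  next
    case False
    then show ?thesis using X by (intro exI[of _ X]) (auto simp: prefix_card_Suc)
  qed
qed

text \<open>Among the sets of \<^term>\<open>j\<close> elements the prefix \<^term>\<open>{..<j}\<close> has the least rank, namely
  \<^term>\<open>prefix_card S j\<close>; so these numbers are isomorphism invariants.\<close>

lemma nested_matroid_isomorphic_prefix_card_le:
  assumes iso: "matroid_isomorphic {..<n} (nested_matroid n S) {..<n} (nested_matroid n T)"
    and "j \<le> n"
  shows "prefix_card T j \<le> prefix_card S j"
proof -
  obtain f where f: "bij_betw f {..<n} {..<n}"
    "\<And>X. X \<subseteq> {..<n} \<Longrightarrow> X \<in> nested_matroid n S \<longleftrightarrow> f ` X \<in> nested_matroid n T"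
    using iso unfolding matroid_isomorphic_def by blast
  have jn: "{..<j} \<subseteq> {..<n}" using \<open>j \<le> n\<close> by auto
  have inj: "inj_on f {..<n}" and im: "f ` {..<n} = {..<n}" using f(1) by (auto simp: bij_betw_def)
  \<comment> \<open>The image of the prefix contains an independent set of size
    \<open>prefix_card T j\<close>. Pulled back along \<open>f\<close>, it is an independent subset
    of \<open>{..<j}\<close> for \<open>S\<close>.\<close>
  have "card (f ` {..<j}) = j" using card_image[OF inj_on_subset[OF inj jn]] by simp
  then obtain Y where Y: "Y \<subseteq> f ` {..<j}" "card Y = prefix_card T j"
      "\<And>i. prefix_card Y i \<le> prefix_card T i"
    using nested_matroid_rank_ge[of "f ` {..<j}" j T] by auto
  obtain X where X: "X \<subseteq> {..<j}" "Y = f ` X" using Y(1) by (metis subset_imageE)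
  have "Y \<subseteq> {..<n}" using Y(1) image_mono[OF jn, of f] im by simp
  then have "f ` X \<in> nested_matroid n T" using X Y(3) by (auto simp: nested_matroid_def)
  then have "X \<in> nested_matroid n S" using f(2)[of X] order_trans[OF X(1) jn] by simp
  then have "prefix_card X j \<le> prefix_card S j" using \<open>j \<le> n\<close> by (simp add: nested_matroid_def)
  moreover have "card Y = card X" unfolding X(2)
    by (intro card_image inj_on_subset[OF inj order_trans[OF X(1) jn]])
  ultimately show ?thesis using X(1) Y(2) by (simp add: prefix_card_all)
qed

lemma nested_matroid_isomorphic_imp_eq:
  assumes "S \<subseteq> {..<n}" "T \<subseteq> {..<n}"
    and iso: "matroid_isomorphic {..<n} (nested_matroid n S) {..<n} (nested_matroid n T)"
  shows "S = T"
  using assms(1,2)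
  by (rule prefix_card_inject)
    (metis iso matroid_isomorphic_sym nested_matroid_isomorphic_prefix_card_le le_antisym)

text \<open>With increasing weights, replacing an element of a basis by a later one gives a basis again;
  hence independence is decided by the ranks of the prefixes.\<close>

lemma monotone_threshold_imp_nested:
  fixes w :: "nat \<Rightarrow> real"
  assumes M: "matroid {..<n} \<I>"
    and w: "\<And>B. B \<subseteq> {..<n} \<Longrightarrow> card B = matroid_rank \<I> \<Longrightarrow> B \<in> \<I> \<longleftrightarrow> sum w B > 0"
    and mono: "\<And>i j. i \<le> j \<Longrightarrow> j < n \<Longrightarrow> w i \<le> w j"
  obtains S where "S \<subseteq> {..<n}" "\<I> = nested_matroid n S"
proof -
  have sub: "X \<subseteq> {..<n}" if "X \<in> \<I>" for X using M that by (auto simp: matroid_def)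
  \<comment> \<open>The rank of the prefix \<open>{..<j}\<close>.\<close>
  define r where "r j = Max (card ` {X\<in>\<I>. X \<subseteq> {..<j}})" for j
  have fin: "finite (card ` {X\<in>\<I>. X \<subseteq> {..<j}})" for j using matroid_finite(1)[OF M] by auto
  have r_ge: "card X \<le> r j" if "X \<in> \<I>" "X \<subseteq> {..<j}" for X j
    unfolding r_def using fin that by (intro Max_ge) auto
  have r_attained: "\<exists>X\<in>\<I>. X \<subseteq> {..<j} \<and> card X = r j" for j
  proof -
    have "{} \<in> {X\<in>\<I>. X \<subseteq> {..<j}}" using M by (simp add: matroid_def)
    then have "card ` {X\<in>\<I>. X \<subseteq> {..<j}} \<noteq> {}" by blast
    from Max_in[OF fin this] show ?thesis unfolding r_def by auto
  qed
  have r_Suc: "r j \<le> r (Suc j)" "r (Suc j) \<le> Suc (r j)" for j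
  proof -
    obtain X where "X \<in> \<I>" "X \<subseteq> {..<j}" "card X = r j" using r_attained by metis
    then show "r j \<le> r (Suc j)" using r_ge[of X "Suc j"] by force
    obtain Y where Y: "Y \<in> \<I>" "Y \<subseteq> {..<Suc j}" "card Y = r (Suc j)" using r_attained by metis
    have "Y - {j} \<in> \<I>" using matroid_subset[OF M Y(1)] by auto
    moreover have "Y - {j} \<subseteq> {..<j}" using Y(2) by auto
    ultimately have "card (Y - {j}) \<le> r j" using r_ge by blast
    moreover have "card Y \<le> Suc (card (Y - {j}))"
      using matroid_finite(2)[OF M Y(1)] card_Diff_singleton_if[of Y j] by auto
    ultimately show "r (Suc j) \<le> Suc (r j)" using Y(3) by simp
  qed
  \<comment> \<open>Each position raises the rank by 0 or 1, so recording the rises makes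
    \<open>r\<close> the prefix count of \<open>S\<close>.\<close>
  define S where "S = {j. j < n \<and> r j < r (Suc j)}"
  have "r 0 = 0" using r_attained[of 0] by auto
  have prefS: "prefix_card S j = r j" if "j \<le> n" for j
    using that
  proof (induction j)
    case (Suc j)
    then show ?case using r_Suc[of j] by (auto simp: prefix_card_Suc S_def)
  qed (simp add: \<open>r 0 = 0\<close>)
  have "X \<in> nested_matroid n S" if "X \<in> \<I>" for X
    using r_ge[of "X \<inter> {..<j}" j for j] matroid_subset[OF M that] sub[OF that] prefS
    by (auto simp: nested_matroid_def prefix_card_def)
  moreover have "X \<in> \<I>" if X: "X \<in> nested_matroid n S" for X
  proof -
    have "X \<inter> {..<j} \<in> \<I>" if "j \<le> n" for j
      using that
    proof (induction j)
      case 0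
      then show ?case using M by (simp add: matroid_def)
    next
      case (Suc j)
      let ?X = "X \<inter> {..<j}"
      have IH: "?X \<in> \<I>" using Suc by simp
      show ?case
      proof (cases "j \<in> X")
        case False
        then have "X \<inter> {..<Suc j} = ?X" by (auto simp: less_Suc_eq)
        then show ?thesis using IH by simp
      next
        case True
        have ins: "X \<inter> {..<Suc j} = insert j ?X" using True by (auto simp: less_Suc_eq)
        have "prefix_card X (Suc j) \<le> r (Suc j)"
          using X Suc.prems prefS[of "Suc j"] by (auto simp: nested_matroid_def)
        then have "card ?X < r (Suc j)" using True prefix_card_Suc[of X j] by (simp add: prefix_card_def[of X j])
        moreover obtain Y where Y: "Y \<in> \<I>" "Y \<subseteq> {..<Suc j}" "card Y = r (Suc j)"
          using r_attained by metis
        ultimately obtain y where y: "y \<in> Y - ?X" "insert y ?X \<in> \<I>"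
          using matroid_augment[OF M IH Y(1)] by auto
        have "y \<le> j" using y(1) Y(2) by auto
        \<comment> \<open>Augmentation may produce a \<open>y\<close> below \<open>j\<close>. If the
          basis \<open>B\<close> lacks \<open>j\<close>, exchanging \<open>y\<close> for
          \<open>j\<close> does not lower its weight, so the result is a basis and contains
          \<open>insert j ?X\<close>.\<close>
        obtain B where B: "B \<in> \<I>" "insert y ?X \<subseteq> B" "card B = matroid_rank \<I>"
          using matroid_extend_to_rank[OF M y(2)] by blast
        have "insert j ?X \<in> \<I>"
        proof (cases "j \<in> B")
          case True
          then show ?thesis using matroid_subset[OF M B(1)] B(2) by auto
        next
          case False
          have fB: "finite B" "y \<in> B" using matroid_finite(2)[OF M B(1)] B(2) by auto
          note sw = swap_elem_sum_card[OF fB False]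
          have "sum w B > 0" using w B sub by blast
          then have "sum w (swap_elem y j B) > 0"
            using sw(1)[of w] mono[OF \<open>y \<le> j\<close>] Suc.prems by simp
          moreover have "swap_elem y j B \<subseteq> {..<n}"
            using sub[OF B(1)] Suc.prems by (auto simp: swap_elem_def)
          ultimately have "swap_elem y j B \<in> \<I>" using w sw(2) B(3) by simp
          moreover have "insert j ?X \<subseteq> swap_elem y j B"
            using B(2) y(1) by (auto simp: swap_elem_def)
          ultimately show ?thesis using matroid_subset[OF M] by blast
        qed
        then show ?thesis using ins by simp
      qed
    qed
    moreover have "X \<inter> {..<n} = X" using X by (auto simp: nested_matroid_def)
    ultimately show ?thesis by (metis order_refl)
  qed
  ultimately have "\<I> = nested_matroid n S" by blast
  moreover have "S \<subseteq> {..<n}" by (auto simp: S_def)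
  ultimately show ?thesis using that by blast
qed

text \<open>Listing the ground set by nondecreasing weight and replacing elements by their positions
  gives a copy on \<open>{..<n}\<close> with monotone weights, which is nested.\<close>

lemma threshold_matroid_isomorphic_nested:
  assumes "threshold_matroid E \<I>" "card E = n"
  obtains S where "S \<subseteq> {..<n}" "threshold_matroid {..<n} (nested_matroid n S)"
    "matroid_isomorphic {..<n} (nested_matroid n S) E \<I>"
proof -
  obtain w :: "'a \<Rightarrow> real" where M: "matroid E \<I>" and
    w: "\<And>B. B \<subseteq> E \<Longrightarrow> card B = matroid_rank \<I> \<Longrightarrow> B \<in> \<I> \<longleftrightarrow> sum w B > 0"
    using assms(1) unfolding threshold_matroid_iff by blast
  have "finite E" "\<I> \<subseteq> Pow E" using M by (auto simp: matroid_def)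
  then obtain es where es: "set es = E" "distinct es" using finite_distinct_list by blast
  define ys where "ys = sort_key w es"
  have ys: "set ys = E" "distinct ys" "length ys = n" "sorted (map w ys)"
    using es assms(2) distinct_card[of es] by (auto simp: ys_def)
  have g: "bij_betw ((!) ys) {..<n} E" using ys by (intro bij_betw_nth) auto
  define f where "f = inv_into {..<n} ((!) ys)"
  have f: "bij_betw f E {..<n}" unfolding f_def using g by (rule bij_betw_inv_into)
  let ?\<J> = "(`) f ` \<I>"
  have inj: "inj_on f E" and im: "f ` E = {..<n}" using f by (auto simp: bij_betw_def)
  have J: "matroid {..<n} ?\<J>" "matroid_rank ?\<J> = matroid_rank \<I>"
    using matroid_image[OF M f] by auto
  have "B \<in> ?\<J> \<longleftrightarrow> (\<Sum>b\<in>B. w (ys ! b)) > 0" if B: "B \<subseteq> {..<n}" "card B = matroid_rank ?\<J>" for B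
  proof -
    let ?B = "(!) ys ` B"
    have injB: "inj_on ((!) ys) B" using g B(1) inj_on_subset by (auto simp: bij_betw_def)
    have sub: "?B \<subseteq> E" using g B(1) by (auto simp: bij_betw_def)
    have fB: "f ` ?B = B"
      unfolding f_def using g B(1) by (simp add: bij_betw_def inv_into_image_cancel)
    have "B \<in> ?\<J> \<longleftrightarrow> ?B \<in> \<I>"
      using image_mem_image_image_iff[OF inj \<open>\<I> \<subseteq> Pow E\<close> sub] fB by simp
    also have "\<dots> \<longleftrightarrow> sum w ?B > 0" using w[OF sub] card_image[OF injB] B(2) J(2) by simp
    also have "sum w ?B = (\<Sum>b\<in>B. w (ys ! b))" by (simp add: sum.reindex[OF injB])
    finally show ?thesis .
  qed
  moreover have "w (ys ! i) \<le> w (ys ! j)" if "i \<le> j" "j < n" for i j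
    using sorted_nth_mono[OF ys(4), of i j] that ys(3) by simp
  ultimately obtain S where S: "S \<subseteq> {..<n}" "?\<J> = nested_matroid n S"
    using monotone_threshold_imp_nested[OF J(1), of "\<lambda>i. w (ys ! i)"] by metis
  have "matroid_isomorphic E \<I> {..<n} (nested_matroid n S)"
    using matroid_isomorphic_image[OF f \<open>\<I> \<subseteq> Pow E\<close>] S(2) by simp
  moreover have "threshold_matroid {..<n} (nested_matroid n S)"
    using threshold_matroid_image[OF assms(1) f] S(2) by simp
  ultimately show ?thesis using that S(1) matroid_isomorphic_sym by blast
qed

section \<open>Threshold words\<close>

text \<open>Both \<^term>\<open>B\<^sub>1\<close>, \<^term>\<open>B\<^sub>2\<close> below are obtained from \<^term>\<open>S\<close> by moving elements up, so they are
  bases; \<^term>\<open>C\<^sub>1\<close> has too many elements up to \<^term>\<open>q\<close> and \<^term>\<open>C\<^sub>2\<close> too many below \<^term>\<open>s\<close>.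
  As multisets, \<^term>\<open>B\<^sub>1\<close> and \<^term>\<open>B\<^sub>2\<close> together have the same elements as \<^term>\<open>C\<^sub>1\<close> and \<^term>\<open>C\<^sub>2\<close>.\<close>

lemma nested_matroid_not_threshold:
  assumes S: "S \<subseteq> {..<n}"
    and mem: "p \<in> S" "x\<^sub>1 \<in> S" "x\<^sub>2 \<in> S" "s \<in> S" "q \<notin> S" "y\<^sub>1 \<notin> S" "y\<^sub>2 \<notin> S" "z \<notin> S"
    and less: "p < q" "q < x\<^sub>1" "q < x\<^sub>2" "x\<^sub>1 < y\<^sub>1" "x\<^sub>2 < y\<^sub>2" "y\<^sub>1 < s" "y\<^sub>2 < s" "s < z" "z < n"
    and neq: "x\<^sub>1 \<noteq> x\<^sub>2" "y\<^sub>1 \<noteq> y\<^sub>2"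
  shows "\<not> threshold_matroid {..<n} (nested_matroid n S)"
proof
  let ?N = "nested_matroid n S"
  assume "threshold_matroid {..<n} ?N"
  then obtain w :: "nat \<Rightarrow> real" where
    w: "\<And>B. B \<subseteq> {..<n} \<Longrightarrow> card B = card S \<Longrightarrow> B \<in> ?N \<longleftrightarrow> sum w B > 0"
    unfolding threshold_matroid_iff matroid_rank_nested_matroid[OF S] by blast
  define B\<^sub>1 B\<^sub>2 C\<^sub>1 C\<^sub>2 where "B\<^sub>1 = swap_elem x\<^sub>1 y\<^sub>1 (swap_elem p q S)"
    and "B\<^sub>2 = swap_elem x\<^sub>2 y\<^sub>2 (swap_elem s z S)"
    and "C\<^sub>1 = swap_elem x\<^sub>1 q (swap_elem x\<^sub>2 z S)"
    and "C\<^sub>2 = swap_elem p y\<^sub>1 (swap_elem s y\<^sub>2 S)"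
  note defs = B\<^sub>1_def B\<^sub>2_def C\<^sub>1_def C\<^sub>2_def
  have fin: "finite S" using S finite_subset by blast
  have fin_swap: "finite (swap_elem a b S)" for a b using fin by (simp add: swap_elem_def)
  have SN: "S \<in> ?N" using S by (simp add: nested_matroid_def)
  have "B\<^sub>1 \<in> ?N" unfolding B\<^sub>1_def
    by (intro nested_matroid_swap_elem SN) (use mem less neq in \<open>auto simp: swap_elem_mem\<close>)
  moreover have "B\<^sub>2 \<in> ?N" unfolding B\<^sub>2_def
    by (intro nested_matroid_swap_elem SN) (use mem less neq in \<open>auto simp: swap_elem_mem\<close>)
  moreover have "C\<^sub>1 \<notin> ?N"
  proof -
    have "int (prefix_card C\<^sub>1 (Suc q)) = int (prefix_card (swap_elem x\<^sub>2 z S) (Suc q)) + 1"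
      unfolding C\<^sub>1_def by (subst prefix_card_swap_elem) (use mem less neq in \<open>auto simp: swap_elem_mem\<close>)
    also have "int (prefix_card (swap_elem x\<^sub>2 z S) (Suc q)) = int (prefix_card S (Suc q))"
      by (subst prefix_card_swap_elem) (use mem less neq in auto)
    finally show ?thesis using less unfolding nested_matroid_def by (auto intro!: exI[of _ "Suc q"])
  qed
  moreover have "C\<^sub>2 \<notin> ?N"
  proof -
    have "int (prefix_card C\<^sub>2 s) = int (prefix_card (swap_elem s y\<^sub>2 S) s)"
      unfolding C\<^sub>2_def by (subst prefix_card_swap_elem) (use mem less neq in \<open>auto simp: swap_elem_mem\<close>)
    also have "\<dots> = int (prefix_card S s) + 1"
      by (subst prefix_card_swap_elem) (use mem less neq in auto)
    finally show ?thesis using less unfolding nested_matroid_def by (auto intro!: exI[of _ s])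
  qed
  moreover have "B\<^sub>1 \<subseteq> {..<n}" "B\<^sub>2 \<subseteq> {..<n}" "C\<^sub>1 \<subseteq> {..<n}" "C\<^sub>2 \<subseteq> {..<n}"
    using S less by (auto simp: defs swap_elem_def)
  moreover have "card B\<^sub>1 = card S" "sum w B\<^sub>1 = sum w S - w p + w q - w x\<^sub>1 + w y\<^sub>1"
    unfolding B\<^sub>1_def using mem less neq fin
    by (simp_all add: swap_elem_sum_card fin_swap swap_elem_mem)
  moreover have "card B\<^sub>2 = card S" "sum w B\<^sub>2 = sum w S - w s + w z - w x\<^sub>2 + w y\<^sub>2"
    unfolding B\<^sub>2_def using mem less neq fin
    by (simp_all add: swap_elem_sum_card fin_swap swap_elem_mem)
  moreover have "card C\<^sub>1 = card S" "sum w C\<^sub>1 = sum w S - w x\<^sub>2 + w z - w x\<^sub>1 + w q"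
    unfolding C\<^sub>1_def using mem less neq fin
    by (simp_all add: swap_elem_sum_card fin_swap swap_elem_mem)
  moreover have "card C\<^sub>2 = card S" "sum w C\<^sub>2 = sum w S - w s + w y\<^sub>2 - w p + w y\<^sub>1"
    unfolding C\<^sub>2_def using mem less neq fin
    by (simp_all add: swap_elem_sum_card fin_swap swap_elem_mem)
  ultimately show False using w[of B\<^sub>1] w[of B\<^sub>2] w[of C\<^sub>1] w[of C\<^sub>2] by linarith
qed

text \<open>An element \<open>b\<close> counts towards prefix \<open>j\<close> iff
  \<open>b < j\<close>, so a linear combination of prefix counts is a sum of weights of elements.
  The constant term is spread evenly over the \<open>card S\<close> elements of
  \<open>B\<close>.\<close>

lemma prefix_card_affine_weights:
  fixes c :: "nat \<Rightarrow> real"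
  assumes S: "S \<subseteq> {..<n}" "S \<noteq> {}"
  obtains w :: "nat \<Rightarrow> real" where
    "\<And>B. B \<subseteq> {..<n} \<Longrightarrow> card B = card S \<Longrightarrow>
      sum w B = 1 - (\<Sum>j\<le>n. c j * (real (prefix_card B j) - real (prefix_card S j)))"
proof
  define D where "D = 1 + (\<Sum>j\<le>n. c j * real (prefix_card S j))"
  define w where "w b = D / card S - (\<Sum>j\<le>n. c j * of_bool (b < j))" for b
  fix B assume B: "B \<subseteq> {..<n}" "card B = card S"
  have fin: "finite B" "finite S" using B S finite_subset by blast+
  then have "card S \<noteq> 0" using S by simp
  have "(\<Sum>b\<in>B. of_bool (b < j)) = real (prefix_card B j)" for j
    using fin(1) by (simp add: prefix_card_def sum_of_bool_eq lessThan_def)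
  then have "(\<Sum>b\<in>B. \<Sum>j\<le>n. c j * of_bool (b < j)) = (\<Sum>j\<le>n. c j * real (prefix_card B j))"
    by (subst sum.swap) (simp add: sum_distrib_left[symmetric])
  then have "sum w B = D - (\<Sum>j\<le>n. c j * real (prefix_card B j))"
    unfolding w_def using B(2) \<open>card S \<noteq> 0\<close> by (simp add: sum_subtractf)
  then show "sum w B = 1 - (\<Sum>j\<le>n. c j * (real (prefix_card B j) - real (prefix_card S j)))"
    by (simp add: D_def algebra_simps sum_subtractf)
qed

text \<open>An excess persists to the right while positions lie outside \<open>S\<close>, and must
  meet an element of \<open>S\<close> since the counts agree at \<open>n\<close>. From there it
  persists to the left through the run of \<open>S\<close>, which cannot reach 0, where there is no
  excess. So only prefixes ending just before an element of \<open>S\<close> that follows a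
  non-element need testing.\<close>

lemma prefix_card_excess_at_ascent:
  assumes S: "S \<subseteq> {..<n}" and B: "B \<subseteq> {..<n}" "card B = card S"
    and j: "j \<le> n" "prefix_card S j < prefix_card B j"
  obtains i where "Suc i < n" "i \<notin> S" "Suc i \<in> S" "prefix_card S (Suc i) < prefix_card B (Suc i)"
proof -
  have "\<exists>j\<in>S. prefix_card S j < prefix_card B j"
    using j
  proof (induction j rule: inc_induct)
    case base
    then show ?case using S B by (simp add: prefix_card_all)
  next
    case (step j)
    show ?case
    proof (cases "j \<in> S")
      case False
      then show ?thesis using step by (simp add: prefix_card_Suc)
    qed (use step in blast)
  qed
  then obtain k where k: "k \<in> S" "prefix_card S k < prefix_card B k" by blast
  then have "\<exists>i. Suc i \<in> S \<and> i \<notin> S \<and> prefix_card S (Suc i) < prefix_card B (Suc i)"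
  proof (induction k)
    case (Suc k)
    show ?case
    proof (cases "k \<in> S")
      case True
      then show ?thesis using Suc by (auto simp: prefix_card_Suc of_bool_def split: if_splits)
    qed (use Suc.prems in blast)
  qed simp
  then show ?thesis using that S by blast
qed

text \<open>The weights make \<^term>\<open>1 - sum w B\<close> a combination of the excesses of \<^term>\<open>B\<close> over \<^term>\<open>S\<close> at
  \<^term>\<open>j\<^sub>1\<close>, at \<^term>\<open>j\<^sub>2\<close>, and, with a dominating coefficient, at the prefixes where no excess can be
  negative (those consisting of loops, or having a complement of coloops). The last assumption
  bounds the difference of the excesses at \<^term>\<open>j\<^sub>1\<close> and \<^term>\<open>j\<^sub>2\<close> on one side.\<close>

lemma nested_matroid_threshold:
  assumes S: "S \<subseteq> {..<n}" "S \<noteq> {}" and j: "j\<^sub>1 \<le> j\<^sub>2" "j\<^sub>2 \<le> n"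
    and ascents: "\<And>i p z. Suc i < n \<Longrightarrow> i \<notin> S \<Longrightarrow> Suc i \<in> S \<Longrightarrow> p \<in> S \<Longrightarrow> p < i \<Longrightarrow>
      z \<notin> S \<Longrightarrow> Suc i < z \<Longrightarrow> z < n \<Longrightarrow> Suc i \<in> {j\<^sub>1, j\<^sub>2}"
    and gap: "card (S \<inter> {j\<^sub>1..<j\<^sub>2}) \<le> 1 \<or> card ({j\<^sub>1..<j\<^sub>2} - S) \<le> 1"
  shows "threshold_matroid {..<n} (nested_matroid n S)"
proof -
  define u where "u B j = real (prefix_card B j) - real (prefix_card S j)" for B j
  have u_ge: "u B j \<ge> - real n" if "j \<le> n" for B j
    using prefix_card_le[of S j] that by (simp add: u_def)
  have u_diff: "u B j\<^sub>2 - u B j\<^sub>1 = real (card (B \<inter> {j\<^sub>1..<j\<^sub>2})) - real (card (S \<inter> {j\<^sub>1..<j\<^sub>2}))" for B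
    using prefix_card_split[OF j(1)] by (simp add: u_def)
  \<comment> \<open>Two inequalities are merged into one. If \<open>S\<close> has at most one
    element between the prefixes, an excess at \<open>j\<^sub>1\<close> keeps the value at
    \<open>j\<^sub>2\<close> nonnegative; if it misses at most one, an excess at
    \<open>j\<^sub>2\<close> keeps the value at \<open>j\<^sub>1\<close> nonnegative. The
    coefficient \<open>n + 1\<close> on the value kept nonnegative outweighs the other value, which
    is at least \<open>- n\<close>.\<close>
  obtain p q :: real where pq: "p \<ge> 0" "q \<ge> 0"
    "\<And>B. u B j\<^sub>1 \<ge> 1 \<or> u B j\<^sub>2 \<ge> 1 \<Longrightarrow> p * u B j\<^sub>1 + q * u B j\<^sub>2 \<ge> 1"
  proof (cases "card (S \<inter> {j\<^sub>1..<j\<^sub>2}) \<le> 1")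
    case True
    have "u B j\<^sub>1 + (n + 1) * u B j\<^sub>2 \<ge> 1" if "u B j\<^sub>1 \<ge> 1 \<or> u B j\<^sub>2 \<ge> 1" for B
    proof (cases "u B j\<^sub>2 \<ge> 1")
      case True
      then have "(n + 1) * u B j\<^sub>2 \<ge> n + 1" using mult_left_mono[OF True, of "n + 1"] by simp
      then show ?thesis using u_ge[OF order_trans[OF j], of B] by linarith
    next
      case False
      moreover have "u B j\<^sub>2 \<ge> 0"
        using u_diff[of B] \<open>card (S \<inter> {j\<^sub>1..<j\<^sub>2}) \<le> 1\<close> that False by simp
      ultimately show ?thesis using that by (simp add: add_increasing2)
    qed
    then show thesis using that[of 1 "n + 1"] by simp
  next
    case False
    then have 1: "card ({j\<^sub>1..<j\<^sub>2} - S) \<le> 1" using gap by simp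
    have diff: "u B j\<^sub>2 - u B j\<^sub>1 \<le> 1" for B
    proof -
      have "card (B \<inter> {j\<^sub>1..<j\<^sub>2}) \<le> card {j\<^sub>1..<j\<^sub>2}" by (intro card_mono) auto
      also have "\<dots> = card (S \<inter> {j\<^sub>1..<j\<^sub>2}) + card ({j\<^sub>1..<j\<^sub>2} - S)"
        using card_Int_Diff[of "{j\<^sub>1..<j\<^sub>2}" S] by (simp add: Int_commute)
      finally show ?thesis using 1 u_diff[of B] by simp
    qed
    have "(n + 1) * u B j\<^sub>1 + u B j\<^sub>2 \<ge> 1" if "u B j\<^sub>1 \<ge> 1 \<or> u B j\<^sub>2 \<ge> 1" for B
    proof (cases "u B j\<^sub>1 \<ge> 1")
      case True
      then have "(n + 1) * u B j\<^sub>1 \<ge> n + 1" using mult_left_mono[OF True, of "n + 1"] by simp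
      then show ?thesis using u_ge[OF j(2), of B] by linarith
    next
      case False
      then show ?thesis using that diff[of B] by (simp add: add_increasing)
    qed
    then show thesis using that[of "n + 1" 1] by simp
  qed
  define K where "K = {j. j \<le> n \<and> (S \<inter> {..<j} = {} \<or> {j..<n} \<subseteq> S)}"
  have K: "K \<subseteq> {..n}" "finite K" by (auto simp: K_def)
  have u_nonneg: "u B j \<ge> 0" if "j \<in> K" and B: "B \<subseteq> {..<n}" "card B = card S" for B j
  proof (cases "S \<inter> {..<j} = {}")
    case True
    then show ?thesis by (simp add: u_def prefix_card_def)
  next
    case False
    then have jn: "j \<le> n" "{j..<n} \<subseteq> S" using \<open>j \<in> K\<close> by (auto simp: K_def)
    have "prefix_card S j + card (S \<inter> {j..<n}) = prefix_card B j + card (B \<inter> {j..<n})"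
      using prefix_card_split[OF jn(1)] S(1) B by (metis prefix_card_all)
    moreover have "card (B \<inter> {j..<n}) \<le> card (S \<inter> {j..<n})"
      using jn(2) by (intro card_mono) auto
    ultimately show ?thesis by (simp add: u_def)
  qed
  \<comment> \<open>One unit of excess on \<open>K\<close> must outweigh the other two terms, whose
    sum is at least \<open>- (p + q) * n\<close>.\<close>
  define P where "P = 1 + (p + q) * n"
  \<comment> \<open>The contributions are added, so \<open>j\<^sub>1\<close> and
    \<open>j\<^sub>2\<close> may coincide or lie in \<open>K\<close>.\<close>
  define c where "c j = (if j \<in> K then P else 0) + (if j = j\<^sub>1 then p else 0) + (if j = j\<^sub>2 then q else 0)" for j
  have "P \<ge> 1" using pq by (simp add: P_def)
  have c_nonneg: "c j \<ge> 0" for j using pq \<open>P \<ge> 1\<close> by (simp add: c_def)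
  obtain w where w: "\<And>B. B \<subseteq> {..<n} \<Longrightarrow> card B = card S \<Longrightarrow> sum w B = 1 - (\<Sum>j\<le>n. c j * u B j)"
    using prefix_card_affine_weights[OF S, of c] unfolding u_def by blast
  have c_sum: "(\<Sum>j\<le>n. c j * u B j) = P * (\<Sum>j\<in>K. u B j) + p * u B j\<^sub>1 + q * u B j\<^sub>2" for B
  proof -
    have "(\<Sum>j\<le>n. c j * u B j) = (\<Sum>j\<le>n. if j \<in> K then P * u B j else 0)
        + (\<Sum>j\<le>n. if j = j\<^sub>1 then p * u B j else 0) + (\<Sum>j\<le>n. if j = j\<^sub>2 then q * u B j else 0)"
      unfolding c_def sum.distrib[symmetric] by (intro sum.cong) (auto simp: algebra_simps)
    also have "(\<Sum>j\<le>n. if j \<in> K then P * u B j else 0) = (\<Sum>j\<in>K. P * u B j)"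
      using K(1) by (simp add: sum.inter_restrict[symmetric] Int_absorb1)
    finally show ?thesis using j by (simp add: sum_distrib_left)
  qed
  have "B \<in> nested_matroid n S \<longleftrightarrow> sum w B > 0" if B: "B \<subseteq> {..<n}" "card B = card S" for B
  proof
    assume "B \<in> nested_matroid n S"
    then have "c j * u B j \<le> 0" if "j \<le> n" for j
      using that c_nonneg by (auto simp: nested_matroid_def u_def intro!: mult_nonneg_nonpos)
    then have "(\<Sum>j\<le>n. c j * u B j) \<le> 0" by (intro sum_nonpos) auto
    then show "sum w B > 0" using w[OF B] by simp
  next
    assume pos: "sum w B > 0"
    show "B \<in> nested_matroid n S"
    proof (rule ccontr)
      assume "B \<notin> nested_matroid n S"
      then obtain k where "k \<le> n" "prefix_card S k < prefix_card B k"
        using B(1) by (auto simp: nested_matroid_def not_le)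
      then obtain i where i: "Suc i < n" "i \<notin> S" "Suc i \<in> S" "prefix_card S (Suc i) < prefix_card B (Suc i)"
        using prefix_card_excess_at_ascent[OF S(1) B] by blast
      have ui: "u B (Suc i) \<ge> 1" using i(4) by (simp add: u_def)
      have K_nonneg: "(\<Sum>j\<in>K. u B j) \<ge> 0" using u_nonneg[OF _ B] by (intro sum_nonneg)
      have "(\<Sum>j\<le>n. c j * u B j) \<ge> 1"
      proof (cases "Suc i \<in> K")
        case True
        then have "(\<Sum>j\<in>K. u B j) \<ge> 1"
          using ui member_le_sum[of "Suc i" K "u B"] u_nonneg[OF _ B] K(2) by force
        then have "P * (\<Sum>j\<in>K. u B j) \<ge> P" using \<open>P \<ge> 1\<close> by (simp add: mult_le_cancel_left1)
        moreover have "p * u B j\<^sub>1 \<ge> p * - real n" "q * u B j\<^sub>2 \<ge> q * - real n"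
          by (intro mult_left_mono u_ge pq order_trans[OF j] j)+
        ultimately show ?thesis unfolding c_sum by (simp add: P_def algebra_simps)
      next
        case False
        \<comment> \<open>Outside \<open>K\<close> the ascent has an element of \<open>S\<close>
          before it and a non-element after it, so \<open>ascents\<close> applies.\<close>
        obtain r where r: "r \<in> S" "r < Suc i" using False i(1) by (auto simp: K_def)
        obtain z where z: "z \<notin> S" "Suc i \<le> z" "z < n" using False i(1) by (auto simp: K_def)
        have "r \<noteq> i" "z \<noteq> Suc i" using r z i by auto
        then have "Suc i \<in> {j\<^sub>1, j\<^sub>2}" using ascents[OF i(1-3) r(1) _ z(1) _ z(3)] r z by simp
        then have "p * u B j\<^sub>1 + q * u B j\<^sub>2 \<ge> 1" using pq(3)[of B] ui by auto
        moreover have "P * (\<Sum>j\<in>K. u B j) \<ge> 0" using K_nonneg \<open>P \<ge> 1\<close> by simp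
        ultimately show ?thesis unfolding c_sum by simp
      qed
      then show False using pos w[OF B] by simp
    qed
  qed
  then show ?thesis
    unfolding threshold_matroid_iff matroid_rank_nested_matroid[OF S(1)]
    using matroid_nested_matroid by blast
qed

section \<open>The threshold criterion in terms of forbidden subsequences\<close>

definition indicator_word :: "nat \<Rightarrow> nat set \<Rightarrow> bool list" where
  "indicator_word n S = map (\<lambda>i. i \<in> S) [0..<n]"

definition threshold_word :: "bool list \<Rightarrow> bool" where
  "threshold_word xs \<longleftrightarrow>
    \<not> subseq [True, False, True, False, True, False, True, False] xs \<and>
    \<not> subseq [True, False, True, True, False, False, True, False] xs"

lemma subseq_indicator_word_iff:
  "subseq ps (indicator_word n S) \<longleftrightarrow>
    (\<exists>is. sorted_wrt (<) is \<and> set is \<subseteq> {..<n} \<and> map (\<lambda>i. i \<in> S) is = ps)"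
proof
  assume "subseq ps (indicator_word n S)"
  then obtain N where N: "ps = map (\<lambda>i. i \<in> S) (nths [0..<n] N)"
    by (auto simp: indicator_word_def subseq_conv_nths nths_map)
  have "sorted_wrt (<) (nths [0..<n] N)"
    using sorted_nths[of "[0..<n]" N] distinct_nthsI[of "[0..<n]" N] by (simp add: strict_sorted_iff)
  then show "\<exists>is. sorted_wrt (<) is \<and> set is \<subseteq> {..<n} \<and> map (\<lambda>i. i \<in> S) is = ps"
    using N set_nths_subset[of "[0..<n]" N] by (intro exI[of _ "nths [0..<n] N"]) auto
next
  assume "\<exists>is. sorted_wrt (<) is \<and> set is \<subseteq> {..<n} \<and> map (\<lambda>i. i \<in> S) is = ps"
  then obtain "is" where "is": "sorted_wrt (<) is" "set is \<subseteq> {..<n}" "map (\<lambda>i. i \<in> S) is = ps" by blast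
  have "subseq is [0..<n]" by (rule sorted_subset_imp_subseq) (use "is" in auto)
  then show "subseq ps (indicator_word n S)"
    unfolding indicator_word_def "is"(3)[symmetric] by (rule subseq_map)
qed

text \<open>The inequalities leave only the order of \<open>y\<^sub>1\<close> and
  \<open>x\<^sub>2\<close> open; its two possibilities are the two patterns. In this form the
  obstruction matches \<open>nested_matroid_not_threshold\<close>.\<close>

lemma threshold_word_indicator_iff:
  "threshold_word (indicator_word n S) \<longleftrightarrow>
    \<not> (\<exists>p q x\<^sub>1 x\<^sub>2 y\<^sub>1 y\<^sub>2 s z. p \<in> S \<and> q \<notin> S \<and> x\<^sub>1 \<in> S \<and> x\<^sub>2 \<in> S \<and> y\<^sub>1 \<notin> S \<and> y\<^sub>2 \<notin> S \<and> s \<in> S \<and> z \<notin> S \<and>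
      p < q \<and> q < x\<^sub>1 \<and> x\<^sub>1 < x\<^sub>2 \<and> x\<^sub>1 < y\<^sub>1 \<and> x\<^sub>2 < y\<^sub>2 \<and> y\<^sub>1 < y\<^sub>2 \<and> y\<^sub>2 < s \<and> s < z \<and> z < n)"
    (is "_ \<longleftrightarrow> \<not> ?bad")
proof -
  let ?s\<^sub>1 = "subseq [True, False, True, False, True, False, True, False] (indicator_word n S)"
  let ?s\<^sub>2 = "subseq [True, False, True, True, False, False, True, False] (indicator_word n S)"
  have 1: ?bad if sub: ?s\<^sub>1
  proof -
    obtain "is" where "is": "sorted_wrt (<) is" "set is \<subseteq> {..<n}"
        "map (\<lambda>i. i \<in> S) is = [True, False, True, False, True, False, True, False]"
      using sub unfolding subseq_indicator_word_iff by (elim exE conjE) (rule that)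
    then obtain p q x\<^sub>1 y\<^sub>1 x\<^sub>2 y\<^sub>2 s z where "is = [p, q, x\<^sub>1, y\<^sub>1, x\<^sub>2, y\<^sub>2, s, z]"
      by (clarsimp simp: map_eq_Cons_conv)
    with "is" show ?bad
      by - (rule exI[of _ p], rule exI[of _ q], rule exI[of _ x\<^sub>1], rule exI[of _ x\<^sub>2],
        rule exI[of _ y\<^sub>1], rule exI[of _ y\<^sub>2], rule exI[of _ s], rule exI[of _ z], simp)
  qed
  have 2: ?bad if sub: ?s\<^sub>2
  proof -
    obtain "is" where "is": "sorted_wrt (<) is" "set is \<subseteq> {..<n}"
        "map (\<lambda>i. i \<in> S) is = [True, False, True, True, False, False, True, False]"
      using sub unfolding subseq_indicator_word_iff by (elim exE conjE) (rule that)
    then obtain p q x\<^sub>1 x\<^sub>2 y\<^sub>1 y\<^sub>2 s z where "is = [p, q, x\<^sub>1, x\<^sub>2, y\<^sub>1, y\<^sub>2, s, z]"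
      by (clarsimp simp: map_eq_Cons_conv)
    with "is" show ?bad
      by - (rule exI[of _ p], rule exI[of _ q], rule exI[of _ x\<^sub>1], rule exI[of _ x\<^sub>2],
        rule exI[of _ y\<^sub>1], rule exI[of _ y\<^sub>2], rule exI[of _ s], rule exI[of _ z], simp)
  qed
  have 3: "?s\<^sub>1 \<or> ?s\<^sub>2" if ?bad
  proof -
    from that obtain p q x\<^sub>1 x\<^sub>2 y\<^sub>1 y\<^sub>2 s z where *:
      "p \<in> S" "q \<notin> S" "x\<^sub>1 \<in> S" "x\<^sub>2 \<in> S" "y\<^sub>1 \<notin> S" "y\<^sub>2 \<notin> S" "s \<in> S" "z \<notin> S"
      "p < q" "q < x\<^sub>1" "x\<^sub>1 < x\<^sub>2" "x\<^sub>1 < y\<^sub>1" "x\<^sub>2 < y\<^sub>2" "y\<^sub>1 < y\<^sub>2" "y\<^sub>2 < s" "s < z" "z < n"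
      by blast
    show ?thesis
    proof (cases "y\<^sub>1 < x\<^sub>2")
      case True
      then have ?s\<^sub>1 unfolding subseq_indicator_word_iff
        using * by (intro exI[of _ "[p, q, x\<^sub>1, y\<^sub>1, x\<^sub>2, y\<^sub>2, s, z]"]) simp
      then show ?thesis ..
    next
      case False
      then have "x\<^sub>2 < y\<^sub>1" using * by (metis linorder_neqE_nat)
      then have ?s\<^sub>2 unfolding subseq_indicator_word_iff
        using * by (intro exI[of _ "[p, q, x\<^sub>1, x\<^sub>2, y\<^sub>1, y\<^sub>2, s, z]"]) simp
      then show ?thesis ..
    qed
  qed
  have "(?s\<^sub>1 \<or> ?s\<^sub>2) = ?bad"
    by (rule iffI, erule disjE, erule 1, erule 2, erule 3)
  then show ?thesis
    unfolding threshold_word_def de_Morgan_disj[symmetric] by (rule arg_cong)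
qed

lemma nested_matroid_threshold_iff:
  assumes S: "S \<subseteq> {..<n}"
  shows "threshold_matroid {..<n} (nested_matroid n S) \<longleftrightarrow> S \<noteq> {} \<and> threshold_word (indicator_word n S)"
proof (intro iffI conjI)
  assume T: "threshold_matroid {..<n} (nested_matroid n S)"
  \<comment> \<open>In rank 0 the only basis is empty, and its weight 0 is not positive.\<close>
  show "S \<noteq> {}"
  proof
    assume "S = {}"
    then have "{} \<in> nested_matroid n S" "matroid_rank (nested_matroid n S) = 0"
      using matroid_rank_nested_matroid[OF S] by (simp_all add: nested_matroid_def)
    then show False using T unfolding threshold_matroid_iff by force
  qed
  show "threshold_word (indicator_word n S)"
  proof (rule ccontr)
    assume "\<not> threshold_word (indicator_word n S)"
    then obtain p q x\<^sub>1 x\<^sub>2 y\<^sub>1 y\<^sub>2 s z where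
      "p \<in> S" "q \<notin> S" "x\<^sub>1 \<in> S" "x\<^sub>2 \<in> S" "y\<^sub>1 \<notin> S" "y\<^sub>2 \<notin> S" "s \<in> S" "z \<notin> S"
      "p < q" "q < x\<^sub>1" "x\<^sub>1 < x\<^sub>2" "x\<^sub>1 < y\<^sub>1" "x\<^sub>2 < y\<^sub>2" "y\<^sub>1 < y\<^sub>2" "y\<^sub>2 < s" "s < z" "z < n"
      unfolding threshold_word_indicator_iff by blast
    then show False
      using nested_matroid_not_threshold[OF S, of p x\<^sub>1 x\<^sub>2 s q y\<^sub>1 y\<^sub>2 z] T by linarith
  qed
next
  assume "S \<noteq> {} \<and> threshold_word (indicator_word n S)"
  then have "S \<noteq> {}" and word: "threshold_word (indicator_word n S)" by auto
  \<comment> \<open>The ascents whose prefix inequalities are not handled by loops or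
    coloops.\<close>
  define A where "A = {i. Suc i < n \<and> i \<notin> S \<and> Suc i \<in> S \<and> (\<exists>p\<in>S. p < i) \<and> (\<exists>z. z \<notin> S \<and> Suc i < z \<and> z < n)}"
  have less: "Suc a < b" if "a \<in> A" "b \<in> A" "a < b" for a b
    using that by (auto simp: A_def intro: Suc_lessI)
  \<comment> \<open>Otherwise \<open>a\<close>, \<open>Suc a\<close>, \<open>x\<close>,
    \<open>y\<close>, \<open>b\<close>, \<open>Suc b\<close>, with an element of \<open>S\<close>
    before and a non-element after them, form the obstruction. Hence between the two ascents
    \<open>S\<close> either has the single element \<open>Suc a\<close> or misses only
    \<open>b\<close>.\<close>
  have two: "x = Suc a \<or> y = b"
    if H: "a \<in> A" "b \<in> A" "x \<in> S" "y \<notin> S" "x \<in> {Suc a..<Suc b}" "y \<in> {Suc a..<Suc b}" for a b x y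
  proof (rule ccontr)
    assume neg: "\<not> (x = Suc a \<or> y = b)"
    obtain p z where pz: "p \<in> S" "p < a" "z \<notin> S" "Suc b < z" "z < n" using H(1,2) by (auto simp: A_def)
    have ab: "a \<notin> S" "Suc a \<in> S" "b \<notin> S" "Suc b \<in> S" using H(1,2) by (auto simp: A_def)
    have "x \<noteq> b" "y \<noteq> Suc a" using H ab by auto
    then have "Suc a < x" "x < b" "Suc a < y" "y < b" using neg H(5,6) by auto
    moreover from this have "Suc a < b" by simp
    ultimately have "\<not> threshold_word (indicator_word n S)"
      unfolding threshold_word_indicator_iff not_not using pz ab H(3,4)
      by - (rule exI[of _ p], rule exI[of _ a], rule exI[of _ "Suc a"], rule exI[of _ x],
        rule exI[of _ y], rule exI[of _ b], rule exI[of _ "Suc b"], rule exI[of _ z], simp)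
    then show False using word by contradiction
  qed
  \<comment> \<open>A middle ascent supplies \<open>Suc b\<close> in \<open>S\<close> and
    \<open>b\<close> outside it, contradicting \<open>two\<close> for the outer pair.\<close>
  have three: "\<not> (a \<in> A \<and> b \<in> A \<and> c \<in> A \<and> a < b \<and> b < c)" for a b c
  proof
    assume *: "a \<in> A \<and> b \<in> A \<and> c \<in> A \<and> a < b \<and> b < c"
    then show False
      using two[of a c "Suc b" b] less[of a b] less[of b c] by (auto simp: A_def)
  qed
  show "threshold_matroid {..<n} (nested_matroid n S)"
  proof (cases "\<exists>a\<in>A. \<exists>b\<in>A. a < b")
    case True
    then obtain a b where ab: "a \<in> A" "b \<in> A" "a < b" by blast
    have only: "i \<in> {a, b}" if "i \<in> A" for i
      using three[of i a b] three[of a i b] three[of a b i] ab that by auto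
    have "card (S \<inter> {Suc a..<Suc b}) \<le> 1 \<or> card ({Suc a..<Suc b} - S) \<le> 1"
    proof (cases "S \<inter> {Suc a..<Suc b} \<subseteq> {Suc a}")
      case True
      then show ?thesis using card_mono[of "{Suc a}"] by auto
    next
      case False
      then obtain x where "x \<in> S" "x \<in> {Suc a..<Suc b}" "x \<noteq> Suc a" by blast
      then have "{Suc a..<Suc b} - S \<subseteq> {b}" using two[OF ab(1,2)] by blast
      then show ?thesis using card_mono[of "{b}"] by auto
    qed
    moreover have "Suc i \<in> {Suc a, Suc b}"
      if "Suc i < n" "i \<notin> S" "Suc i \<in> S" "p \<in> S" "p < i" "z \<notin> S" "Suc i < z" "z < n" for i p z
      using only[of i] that by (auto simp: A_def)
    ultimately show ?thesis
      using ab S \<open>S \<noteq> {}\<close> by (intro nested_matroid_threshold[of S n "Suc a" "Suc b"]) (auto simp: A_def)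
  next
    case False
    \<comment> \<open>With at most one relevant ascent both prefixes are taken equal, and the
      interval between them is empty. Without any, the empty prefix 0 serves as a dummy.\<close>
    obtain a where a: "a \<le> n" "\<And>i. i \<in> A \<Longrightarrow> Suc i = a"
    proof (cases "A = {}")
      case True
      then show ?thesis using that[of 0] by simp
    next
      case nonempty: False
      then obtain b where b: "b \<in> A" by blast
      have "i = b" if "i \<in> A" for i
        using False that b by (meson linorder_neqE_nat)
      then have "Suc i = Suc b" if "i \<in> A" for i using that by blast
      moreover have "Suc b \<le> n" using b by (simp add: A_def)
      ultimately show ?thesis by (rule that[rotated])
    qed
    have "Suc i \<in> {a, a}"
      if "Suc i < n" "i \<notin> S" "Suc i \<in> S" "p \<in> S" "p < i" "z \<notin> S" "Suc i < z" "z < n" for i p z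
      using a(2)[of i] that by (auto simp: A_def)
    then show ?thesis
      using a(1) S \<open>S \<noteq> {}\<close> by (intro nested_matroid_threshold[of S n a a]) auto
  qed
qed

section \<open>Counting words that avoid two patterns\<close>

definition avoiders :: "bool list \<Rightarrow> bool list \<Rightarrow> nat \<Rightarrow> bool list set" where
  "avoiders ps qs n = {xs. length xs = n \<and> \<not> subseq ps xs \<and> \<not> subseq qs xs}"

lemma finite_avoiders: "finite (avoiders ps qs n)"
  by (rule finite_subset[OF _ finite_lists_length_eq[of UNIV n]]) (auto simp: avoiders_def)

lemma card_avoiders_0: "card (avoiders (a # ps) (b # qs) 0) = 1"
proof -
  have "avoiders (a # ps) (b # qs) 0 = {[]}" by (auto simp: avoiders_def)
  then show ?thesis by simp
qed

text \<open>Matching greedily, the first letter of a word strips the head of each pattern that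
  begins with it and leaves the other patterns unchanged.\<close>

lemma card_avoiders_Suc:
  "card (avoiders (a # ps) (b # qs) (Suc n)) =
    card (avoiders (if a then ps else a # ps) (if b then qs else b # qs) n) +
    card (avoiders (if a then a # ps else ps) (if b then b # qs else qs) n)"
    (is "_ = card ?T + card ?F")
proof -
  have "avoiders (a # ps) (b # qs) (Suc n) = Cons True ` ?T \<union> Cons False ` ?F"
    by (auto simp: avoiders_def length_Suc_conv image_iff split: if_splits)
  also have "card \<dots> = card ?T + card ?F"
    by (subst card_Un_disjoint) (auto simp: finite_avoiders card_image)
  finally show ?thesis .
qed

text \<open>One choice of first letter shortens the pattern and the other keeps it, whatever its
  head; this is Pascal's rule, so only the length matters.\<close>

lemma card_avoiders_same: "card (avoiders ps ps n) = (\<Sum>i<length ps. n choose i)"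
proof (induction n arbitrary: ps)
  case 0
  show ?case
  proof (cases ps)
    case (Cons a qs)
    then show ?thesis
      by (simp add: card_avoiders_0 sum.lessThan_Suc_shift del: sum.lessThan_Suc)
  qed (simp add: avoiders_def)
next
  case (Suc n)
  show ?case
  proof (cases ps)
    case (Cons a qs)
    have "card (avoiders ps ps (Suc n)) = (\<Sum>i<length qs. n choose i) + (\<Sum>i<Suc (length qs). n choose i)"
      unfolding Cons card_avoiders_Suc using Suc by simp
    also have "\<dots> = (\<Sum>i<Suc (length qs). Suc n choose i)"
      by (simp add: sum.lessThan_Suc_shift sum.distrib del: sum.lessThan_Suc)
    finally show ?thesis using Cons by simp
  qed (simp add: avoiders_def)
qed

lemma card_avoiders_subseq:
  assumes "subseq ps qs"
  shows "card (avoiders ps qs n) = (\<Sum>i<length ps. n choose i)"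
    "card (avoiders qs ps n) = (\<Sum>i<length ps. n choose i)"
proof -
  have "avoiders ps qs n = avoiders ps ps n" "avoiders qs ps n = avoiders ps ps n"
    using assms subseq_order.order_trans unfolding avoiders_def by blast+
  then show "card (avoiders ps qs n) = (\<Sum>i<length ps. n choose i)"
    "card (avoiders qs ps n) = (\<Sum>i<length ps. n choose i)"
    by (simp_all add: card_avoiders_same)
qed

text \<open>The patterns share the prefix \<open>[True, False, True]\<close>, with remainders
  \<open>?P\<close> and \<open>?Q\<close>. Restoring a common letter turns the count into a sum over
  shorter lengths, which raises the lower index of each binomial by one. Words of length
  \<open>Suc m\<close> are used because the formula involves the length minus one.\<close>

lemma card_threshold_words:
  "card {xs. length xs = Suc m \<and> threshold_word xs} =
    1 + ((m + 2) choose 2) + ((m + 2) choose 4) + ((m + 2) choose 6) + (m choose 6)"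
proof -
  let ?P = "[False, True, False, True, False]" and ?Q = "[True, False, False, True, False]"
  note choose_simps = numeral_eq_Suc binomial_Suc_Suc
  \<comment> \<open>After either first letter one remainder is a subsequence of the other, the
    shorter one having length 4.\<close>
  have G: "card (avoiders ?P ?Q (Suc m)) = ((m + 2) choose 1) + ((m + 2) choose 3) + (m choose 3)" for m
    unfolding card_avoiders_Suc by (simp add: card_avoiders_subseq) (simp add: choose_simps)
  have H\<^sub>1: "card (avoiders (True # ?P) (True # ?Q) (Suc m)) =
      ((m + 2) choose 0) + ((m + 2) choose 2) + ((m + 2) choose 4) + (m choose 4)" for m
  proof (induction m)
    case 0
    then show ?case by (simp add: card_avoiders_Suc card_avoiders_0 choose_simps)
  next
    case (Suc m)
    then show ?case
      using G[of m] by (subst card_avoiders_Suc) (simp add: choose_simps)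
  qed
  have H\<^sub>2: "card (avoiders (False # True # ?P) (False # True # ?Q) (Suc m)) =
      ((m + 2) choose 1) + ((m + 2) choose 3) + ((m + 2) choose 5) + (m choose 5)" for m
  proof (induction m)
    case 0
    then show ?case by (simp add: card_avoiders_Suc card_avoiders_0 choose_simps)
  next
    case (Suc m)
    then show ?case
      using H\<^sub>1[of m] by (subst card_avoiders_Suc) (simp add: choose_simps)
  qed
  have H\<^sub>3: "card (avoiders (True # False # True # ?P) (True # False # True # ?Q) (Suc m)) =
      1 + ((m + 2) choose 2) + ((m + 2) choose 4) + ((m + 2) choose 6) + (m choose 6)" for m
  proof (induction m)
    case 0
    then show ?case by (simp add: card_avoiders_Suc card_avoiders_0 choose_simps)
  next
    case (Suc m)
    then show ?case
      using H\<^sub>2[of m] by (subst card_avoiders_Suc) (simp add: choose_simps)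
  qed
  show ?thesis using H\<^sub>3[of m] by (simp add: avoiders_def threshold_word_def)
qed

section \<open>From words to sets and isomorphism classes\<close>

lemma card_threshold_sets:
  "card {S. S \<subseteq> {..<n} \<and> S \<noteq> {} \<and> threshold_word (indicator_word n S)} =
    ((n + 1) choose 2) + ((n + 1) choose 4) + ((n + 1) choose 6) + ((n - 1) choose 6)"
proof (cases n)
  case 0
  then have "{S. S \<subseteq> {..<n} \<and> S \<noteq> {} \<and> threshold_word (indicator_word n S)} = {}" by auto
  then show ?thesis using 0 by (simp only: card.empty) simp
next
  case (Suc m)
  let ?W = "{xs. length xs = n \<and> threshold_word xs}"
  let ?\<S> = "{S. S \<subseteq> {..<n} \<and> threshold_word (indicator_word n S)}"
  have "inj_on (indicator_word n) (Pow {..<n})"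
    by (auto simp: inj_on_def indicator_word_def)
  then have inj: "inj_on (indicator_word n) ?\<S>" by (rule inj_on_subset) auto
  have "xs \<in> indicator_word n ` ?\<S>" if "xs \<in> ?W" for xs
  proof -
    have "xs = indicator_word n {i. i < n \<and> xs ! i}"
      using that by (auto simp: indicator_word_def intro!: nth_equalityI)
    then show ?thesis using that by (auto intro!: image_eqI[of _ _ "{i. i < n \<and> xs ! i}"])
  qed
  moreover have "indicator_word n ` ?\<S> \<subseteq> ?W" by (auto simp: indicator_word_def)
  ultimately have "indicator_word n ` ?\<S> = ?W" by blast
  then have "card ?\<S> = card ?W" using card_image[OF inj] by simp
  \<comment> \<open>Discarding the empty set, whose word avoids both patterns, cancels the summand
    1.\<close>
  moreover have "{S. S \<subseteq> {..<n} \<and> S \<noteq> {} \<and> threshold_word (indicator_word n S)} = ?\<S> - {{}}" by auto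
  moreover have "{} \<in> ?\<S>" by (simp add: threshold_word_indicator_iff)
  ultimately show ?thesis using card_threshold_words[of m] Suc by simp
qed

theorem theorem34:
  fixes E :: "'a set" and n :: nat
  assumes "finite E" and "card E = n"
  shows "card (threshold_matroid_classes E) =
    ((n + 1) choose 2) + ((n + 1) choose 4) + ((n + 1) choose 6) + ((n - 1) choose 6)"
proof -
  let ?\<S> = "{S. S \<subseteq> {..<n} \<and> S \<noteq> {} \<and> threshold_word (indicator_word n S)}"
  obtain h where h: "bij_betw h {..<n} E"
    using ex_bij_betw_nat_finite[OF assms(1)] assms(2) by (auto simp: atLeast0LessThan)
  define M where "M S = (`) h ` nested_matroid n S" for S
  have iso: "matroid_isomorphic {..<n} (nested_matroid n S) E (M S)" for S
    unfolding M_def by (rule matroid_isomorphic_image[OF h]) (auto simp: nested_matroid_def)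
  have M: "M S \<in> threshold_matroids E" if "S \<in> ?\<S>" for S
    using that threshold_matroid_image[OF _ h] nested_matroid_threshold_iff
    by (simp add: threshold_matroids_def M_def)
  \<comment> \<open>The bijection from threshold sets to classes: injective because \<open>S\<close>
    is an isomorphism invariant, surjective by sorting weights.\<close>
  define \<Phi> where "\<Phi> S = threshold_matroid_iso E `` {M S}" for S
  have "inj_on \<Phi> ?\<S>"
  proof (rule inj_onI)
    fix S T assume ST: "S \<in> ?\<S>" "T \<in> ?\<S>" and eq: "\<Phi> S = \<Phi> T"
    have "(M S, M T) \<in> threshold_matroid_iso E"
      using eq_equiv_class[OF eq[unfolded \<Phi>_def] equiv_threshold_matroid_iso M[OF ST(2)]] .
    then have "matroid_isomorphic E (M S) E (M T)" by (simp add: threshold_matroid_iso_def)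
    then have "matroid_isomorphic {..<n} (nested_matroid n S) {..<n} (nested_matroid n T)"
      using iso matroid_isomorphic_trans matroid_isomorphic_sym by metis
    then show "S = T" using nested_matroid_isomorphic_imp_eq ST by blast
  qed
  moreover have "\<Phi> ` ?\<S> = threshold_matroid_classes E"
  proof (intro equalityI subsetI)
    fix C assume "C \<in> \<Phi> ` ?\<S>"
    then show "C \<in> threshold_matroid_classes E"
      using M unfolding threshold_matroid_classes_def \<Phi>_def by (auto intro: quotientI)
  next
    fix C assume "C \<in> threshold_matroid_classes E"
    then obtain \<I> where \<I>: "\<I> \<in> threshold_matroids E" "C = threshold_matroid_iso E `` {\<I>}"
      unfolding threshold_matroid_classes_def by (rule quotientE)
    then obtain S where S: "S \<subseteq> {..<n}" "threshold_matroid {..<n} (nested_matroid n S)"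
        "matroid_isomorphic {..<n} (nested_matroid n S) E \<I>"
      using threshold_matroid_isomorphic_nested[OF _ assms(2)] unfolding threshold_matroids_def by blast
    have S_mem: "S \<in> ?\<S>" using S(1,2) nested_matroid_threshold_iff by simp
    have "matroid_isomorphic E (M S) E \<I>"
      using S(3) iso matroid_isomorphic_trans matroid_isomorphic_sym by metis
    then have "(M S, \<I>) \<in> threshold_matroid_iso E"
      using M[OF S_mem] \<I>(1) by (simp add: threshold_matroid_iso_def)
    then have "\<Phi> S = C"
      unfolding \<Phi>_def \<I>(2) by (rule equiv_class_eq[OF equiv_threshold_matroid_iso])
    then show "C \<in> \<Phi> ` ?\<S>" using S_mem by blast
  qed
  ultimately have "card (threshold_matroid_classes E) = card ?\<S>"
    using card_image by metis
  then show ?thesis by (simp only: card_threshold_sets)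
qed

end
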